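(* In the normal mixture model $\mathbf Y=\mathbf M_0\boldsymbol\mu_0+\mathrm{diag}(\mathbf M_0\boldsymbol\sigma_0)\mathbf U$ with true number of components $\tau_0$, let $0<\alpha<1$ and define $$\Xi_\alpha(\mathbf y_{obs})=\{\tau:\exists\,\mathbf u^*\in\mathcal U\text{ and }(\mathbf M_\tau,\boldsymbol\mu,\boldsymbol\sigma)\text{ such that }\mathbf y_{obs}=\mathbf M_\tau\boldsymbol\mu+\mathrm{diag}\{\mathbf M_\tau\boldsymbol\sigma\}\mathbf u^*,\ T^P(\mathbf u^*,\tau,\mathbf M_\tau,\boldsymbol\mu,\boldsymbol\sigma)\le\alpha\}.$$ Then $$\Xi_\alpha(\mathbf y_{obs})=\{\tau:\exists\,\widetilde{\mathbf M}_\tau,\ \mathcal F_{(\tau,\widetilde{\mathbf M}_\tau)}(\hat\tau(\mathbf y_{obs})\mid\widetilde{\mathbb A}_\tau(\mathbf y_{obs}),\widetilde{\mathbb B}_\tau(\mathbf y_{obs}))\le\alpha\},$$ where $\widetilde{\mathbb A}_\tau,\widetilde{\mathbb B}_\tau$ are defined by replacing $\mathbf M_\tau$ with $\widetilde{\mathbf M}_\tau$ in the definitions of $\mathbb A_\tau,\mathbb B_\tau$. Also $\mathbb P\{\tau_0\in\Xi_\alpha(\mathbf Y)\}\ge\alpha$, so $\Xi_\alpha(\mathbf y_{obs})$ is a level-$\alpha$ confidence set for $\tau_0$.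
   Context: $\mathbf U\sim N(\mathbf 0,\mathbf I_n)$, $\mathcal U=\mathbb R^n$. For a positive integer $\tau<n$, a membership matrix is $\mathbf M_\tau\in\{0,1\}^{n\times\tau}$, whose $(i,k)$ entry $m_{ik}$ indicates whether observation $i$ belongs to component $k$ (each row has exactly one $1$; $\mathbf M_\tau^\top\mathbf M_\tau$ invertible); $\boldsymbol\mu\in\mathbb R^\tau$, $\boldsymbol\sigma\in(0,\infty)^\tau$ are component means and standard deviations. The true parameter $(\tau_0,\mathbf M_0,\boldsymbol\mu_0,\boldsymbol\sigma_0)$ is, among all parameters $(\tau,\mathbf M_\tau,\boldsymbol\mu_\tau,\boldsymbol\sigma_\tau)$ giving the same $\mathbf M_\tau\boldsymbol\mu_\tau$ and $\mathbf M_\tau\boldsymbol\sigma_\tau$, the one with smallest $\tau$. $\mathcal I_k=\{i:m_{ik}=1\}$; $\mathbf H_\tau=\mathbf M_\tau(\mathbf M_\tau^\top\mathbf M_\tau)^{-1}\mathbf M_\tau^\top$; $\mathbf H_\tau^{(k)}=\mathbf H_\tau[\mathcal I_k,\mathcal I_k]$; $\mathbf y^{(k)}=\mathbf y[\mathcal I_k]$. $\mathbb A_\tau(\mathbf y)=(\mathbf M_\tau^\top\mathbf M_\tau)^{-1}\mathbf M_\tau^\top\mathbf y$; $\mathbb B_\tau(\mathbf y)\in\mathbb R^\tau$ has $k$th entry $\|(I-\mathbf H_\tau^{(k)})\mathbf y^{(k)}\|$; $\mathbb C_\tau(\mathbf y)\in\mathbb R^n$ has subvector on $\mathcal I_k$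 equal to $(I-\mathbf H_\tau^{(k)})\mathbf y^{(k)}/\|(I-\mathbf H_\tau^{(k)})\mathbf y^{(k)}\|$ (with $0/0=0$). $\hat\tau(\cdot)$ is any fixed (measurable) positive-integer-valued estimator of the number of components based on the data vector. For $\mathbf Y'=\mathbf M_\tau\boldsymbol\mu+\mathrm{diag}(\mathbf M_\tau\boldsymbol\sigma)\mathbf U$ put $\mathcal P(k|\mathbf a,\mathbf b)=\mathbb P\{\hat\tau(\mathbf Y')=k\mid\mathbb A_\tau(\mathbf Y')=\mathbf a,\mathbb B_\tau(\mathbf Y')=\mathbf b\}$ and $\mathcal F_{(\tau,\mathbf M_\tau)}(w|\mathbf a,\mathbf b)=\sum_{\{k:\mathcal P(k|\mathbf a,\mathbf b)>\mathcal P(w|\mathbf a,\mathbf b)\}}\mathcal P(k|\mathbf a,\mathbf b)$, which does not depend on $(\boldsymbol\mu,\boldsymbol\sigma)$ (a version of the conditional probabilities free of $(\boldsymbol\mu,\boldsymbol\sigma)$ is used). Let $$B_{(\tau,\mathbf M_\tau)}(\alpha)=\{(\mathbf a,\mathbf b,\mathbf c):\mathcal F_{(\tau,\mathbf M_\tau)}(\hat\tau(\mathbf y^* )|\mathbf a,\mathbf b)\le\alpha\text{ for }\mathbf y^*=\mathbf M_\tau\mathbf a+\mathrm{diag}\{\mathbf M_\tau\mathbf b\}\mathbf c\},$$ $\Gamma_\alpha(\mathbf y)=\{(\tau,\mathbf M_\tau):(\mathbb A_\tau(\mathbf y),\mathbb B_\tau(\mathbf y),\mathbb C_\tau(\mathbf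 y))\in B_{(\tau,\mathbf M_\tau)}(\alpha)\}$, and, for $\mathbf y'=\mathbf M_\tau\boldsymbol\mu+\mathrm{diag}(\mathbf M_\tau\boldsymbol\sigma)\mathbf u$, $$T^P(\mathbf u,\tau,\mathbf M_\tau,\boldsymbol\mu,\boldsymbol\sigma)=\min_{\widetilde{\mathbf M}_\tau}\ \inf\{\alpha':(\tau,\widetilde{\mathbf M}_\tau)\in\Gamma_{\alpha'}(\mathbf y')\},$$ the minimum being over all $n\times\tau$ membership matrices. *)

theory Defs
  imports
    "HOL-Probability.Probability"
    "Jordan_Normal_Form.DL_Submatrix"
    "Jordan_Normal_Form.Gauss_Jordan_Elimination"
begin

(* Vectors and matrices are those with explicit dimensions, since the number of components
   varies inside the statement; the type-indexed vectors of Finite_Cartesian_Product are hidden. *)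
unbundle no vec_syntax
no_notation inner (infix \<open>\<bullet>\<close> 70)
hide_type (open) Finite_Cartesian_Product.vec
hide_const (open) Finite_Cartesian_Product.vec

definition vec_borel :: "nat \<Rightarrow> real vec measure" where
  "vec_borel n =
     vimage_algebra (carrier_vec n) (\<lambda>v. \<lambda>i\<in>{..<n}. v $ i) (\<Pi>\<^sub>M i\<in>{..<n}. (borel :: real measure))"

definition std_normal_vec :: "nat \<Rightarrow> real vec measure" where
  "std_normal_vec n =
     distr (\<Pi>\<^sub>M i\<in>{..<n}. density lborel (\<lambda>x. ennreal (std_normal_density x))) (vec_borel n) (vec n)"

definition euclid_norm :: "real vec \<Rightarrow> real" where
  "euclid_norm v = sqrt (v \<bullet> v)"

definition membership_mat :: "nat \<Rightarrow> nat \<Rightarrow> real mat \<Rightarrow> bool" where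
  "membership_mat n \<tau> M \<longleftrightarrow>
     0 < \<tau> \<and> \<tau> < n \<and> M \<in> carrier_mat n \<tau> \<and>
     (\<forall>i<n. \<forall>k<\<tau>. M $$ (i, k) \<in> {0, 1}) \<and>
     (\<forall>i<n. \<exists>!k. k < \<tau> \<and> M $$ (i, k) = 1) \<and>
     invertible_mat (M\<^sup>T * M)"

definition mixture_param :: "nat \<Rightarrow> nat \<Rightarrow> real mat \<Rightarrow> real vec \<Rightarrow> real vec \<Rightarrow> bool" where
  "mixture_param n \<tau> M \<mu> \<sigma> \<longleftrightarrow>
     membership_mat n \<tau> M \<and> \<mu> \<in> carrier_vec \<tau> \<and> \<sigma> \<in> carrier_vec \<tau> \<and> (\<forall>k<\<tau>. 0 < \<sigma> $ k)"

definition true_mixture_param :: "nat \<Rightarrow> nat \<Rightarrow> real mat \<Rightarrow> real vec \<Rightarrow> real vec \<Rightarrow> bool" where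
  "true_mixture_param n \<tau> M \<mu> \<sigma> \<longleftrightarrow>
     mixture_param n \<tau> M \<mu> \<sigma> \<and>
     (\<forall>\<tau>' M' \<mu>' \<sigma>'. mixture_param n \<tau>' M' \<mu>' \<sigma>' \<and> M' *\<^sub>v \<mu>' = M *\<^sub>v \<mu> \<and> M' *\<^sub>v \<sigma>' = M *\<^sub>v \<sigma> \<longrightarrow> \<tau> \<le> \<tau>')"

definition mixture_data :: "nat \<Rightarrow> real mat \<Rightarrow> real vec \<Rightarrow> real vec \<Rightarrow> real vec \<Rightarrow> real vec" where
  "mixture_data n M \<mu> \<sigma> u = M *\<^sub>v \<mu> + mat_diag n (\<lambda>i. (M *\<^sub>v \<sigma>) $ i) *\<^sub>v u"

definition component_indices :: "nat \<Rightarrow> real mat \<Rightarrow> nat \<Rightarrow> nat set" where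
  "component_indices n M k = {i. i < n \<and> M $$ (i, k) = 1}"

definition subvec :: "'a vec \<Rightarrow> nat set \<Rightarrow> 'a vec" where
  "subvec v I = vec (card {i. i < dim_vec v \<and> i \<in> I}) (\<lambda>i. v $ pick I i)"

definition gram_inverse :: "real mat \<Rightarrow> real mat" where
  "gram_inverse M = the (mat_inverse (M\<^sup>T * M))"

definition hat_mat :: "real mat \<Rightarrow> real mat" where
  "hat_mat M = M * gram_inverse M * M\<^sup>T"

definition component_residual :: "nat \<Rightarrow> real mat \<Rightarrow> nat \<Rightarrow> real vec \<Rightarrow> real vec" where
  "component_residual n M k y =
     (let I = component_indices n M k
      in (1\<^sub>m (card I) - submatrix (hat_mat M) I I) *\<^sub>v subvec y I)"

definition stat_A :: "real mat \<Rightarrow> real vec \<Rightarrow> real vec" where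
  "stat_A M y = (gram_inverse M * M\<^sup>T) *\<^sub>v y"

definition stat_B :: "nat \<Rightarrow> nat \<Rightarrow> real mat \<Rightarrow> real vec \<Rightarrow> real vec" where
  "stat_B n \<tau> M y = vec \<tau> (\<lambda>k. euclid_norm (component_residual n M k y))"

(* Observation i is entry number card {j \<in> I. j < i} of the subvector on its component's index
   set I (pick is inverse to this numbering). In the degenerate case the residual is the zero
   vector, so inverse 0 = 0 gives the convention 0/0 = 0. *)
definition stat_C :: "nat \<Rightarrow> nat \<Rightarrow> real mat \<Rightarrow> real vec \<Rightarrow> real vec" where
  "stat_C n \<tau> M y = vec n (\<lambda>i.
     let k = (THE k. k < \<tau> \<and> M $$ (i, k) = 1);
         r = component_residual n M k y
     in (inverse (euclid_norm r) \<cdot>\<^sub>v r) $ card {j \<in> component_indices n M k. j < i})"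

definition component_estimator :: "nat \<Rightarrow> (real vec \<Rightarrow> nat) \<Rightarrow> bool" where
  "component_estimator n tauhat \<longleftrightarrow>
     tauhat \<in> vec_borel n \<rightarrow>\<^sub>M count_space UNIV \<and> (\<forall>y\<in>carrier_vec n. 0 < tauhat y)"

(* P a b is the conditional law of the estimator given that the two statistics equal a and b.
   The quantifier over \<mu> and \<sigma> is inside: one version serves all means and deviations. *)
definition cond_law_version ::
    "nat \<Rightarrow> (real vec \<Rightarrow> nat) \<Rightarrow> nat \<Rightarrow> real mat \<Rightarrow> (real vec \<Rightarrow> real vec \<Rightarrow> nat pmf) \<Rightarrow> bool" where
  "cond_law_version n tauhat \<tau> M P \<longleftrightarrow>
     (\<forall>a\<in>carrier_vec \<tau>. \<forall>b\<in>carrier_vec \<tau>. 0 \<notin> set_pmf (P a b)) \<and>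
     (\<forall>k. (\<lambda>(a, b). pmf (P a b) k) \<in> borel_measurable (vec_borel \<tau> \<Otimes>\<^sub>M vec_borel \<tau>)) \<and>
     (\<forall>\<mu> \<sigma>. mixture_param n \<tau> M \<mu> \<sigma> \<longrightarrow>
        (let Y = mixture_data n M \<mu> \<sigma>;
             AB = (\<lambda>u. (stat_A M (Y u), stat_B n \<tau> M (Y u)))
         in \<forall>k. AE u in std_normal_vec n.
              pmf (P (stat_A M (Y u)) (stat_B n \<tau> M (Y u))) k =
              real_cond_exp (std_normal_vec n)
                (vimage_algebra (space (std_normal_vec n)) AB (vec_borel \<tau> \<Otimes>\<^sub>M vec_borel \<tau>))
                (indicator {u \<in> space (std_normal_vec n). tauhat (Y u) = k}) u))"

definition F_more_likely :: "(real vec \<Rightarrow> real vec \<Rightarrow> nat pmf) \<Rightarrow> nat \<Rightarrow> real vec \<Rightarrow> real vec \<Rightarrow> real" where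
  "F_more_likely P w a b = (\<Sum>\<^sub>\<infinity>k\<in>{k. pmf (P a b) k > pmf (P a b) w}. pmf (P a b) k)"

(* In the following, P assigns to each (\<tau>, M) a version of the conditional law. *)

definition B_region ::
    "nat \<Rightarrow> (real vec \<Rightarrow> nat) \<Rightarrow> (nat \<Rightarrow> real mat \<Rightarrow> real vec \<Rightarrow> real vec \<Rightarrow> nat pmf) \<Rightarrow>
     nat \<Rightarrow> real mat \<Rightarrow> real \<Rightarrow> (real vec \<times> real vec \<times> real vec) set" where
  "B_region n tauhat P \<tau> M \<alpha> =
     {(a, b, c). a \<in> carrier_vec \<tau> \<and> b \<in> carrier_vec \<tau> \<and> c \<in> carrier_vec n \<and>
        F_more_likely (P \<tau> M) (tauhat (mixture_data n M a b c)) a b \<le> \<alpha>}"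

definition Gamma_set ::
    "nat \<Rightarrow> (real vec \<Rightarrow> nat) \<Rightarrow> (nat \<Rightarrow> real mat \<Rightarrow> real vec \<Rightarrow> real vec \<Rightarrow> nat pmf) \<Rightarrow>
     real \<Rightarrow> real vec \<Rightarrow> (nat \<times> real mat) set" where
  "Gamma_set n tauhat P \<alpha> y =
     {(\<tau>, M). membership_mat n \<tau> M \<and>
        (stat_A M y, stat_B n \<tau> M y, stat_C n \<tau> M y) \<in> B_region n tauhat P \<tau> M \<alpha>}"

(* \<alpha>' ranges over all reals. As F_more_likely takes values in [0, 1], restricting \<alpha>' to [0, 1]
   gives the same infimum. The outer minimum is over a finite set. *)
definition T_profile ::
    "nat \<Rightarrow> (real vec \<Rightarrow> nat) \<Rightarrow> (nat \<Rightarrow> real mat \<Rightarrow> real vec \<Rightarrow> real vec \<Rightarrow> nat pmf) \<Rightarrow>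
     real vec \<Rightarrow> nat \<Rightarrow> real mat \<Rightarrow> real vec \<Rightarrow> real vec \<Rightarrow> real" where
  "T_profile n tauhat P u \<tau> M \<mu> \<sigma> =
     Min ((\<lambda>M'. Inf {\<alpha>'. (\<tau>, M') \<in> Gamma_set n tauhat P \<alpha>' (mixture_data n M \<mu> \<sigma> u)}) `
          {M'. membership_mat n \<tau> M'})"

definition Xi_set ::
    "nat \<Rightarrow> (real vec \<Rightarrow> nat) \<Rightarrow> (nat \<Rightarrow> real mat \<Rightarrow> real vec \<Rightarrow> real vec \<Rightarrow> nat pmf) \<Rightarrow>
     real \<Rightarrow> real vec \<Rightarrow> nat set" where
  "Xi_set n tauhat P \<alpha> y =
     {\<tau>. \<exists>u M \<mu> \<sigma>. u \<in> carrier_vec n \<and> mixture_param n \<tau> M \<mu> \<sigma> \<and>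
        y = mixture_data n M \<mu> \<sigma> u \<and> T_profile n tauhat P u \<tau> M \<mu> \<sigma> \<le> \<alpha>}"

end

theory Submission
  imports Defs
begin

text \<open>
  The data are recovered from the three statistics, \<open>y = M A(y) + diag (M B(y)) C(y)\<close>, because the hat
  matrix averages within components. Hence membership in \<open>\<Gamma>\<^sub>\<alpha>(y)\<close> only says that \<open>F\<close> at
  \<open>\<tau>hat(y)\<close> is at most \<open>\<alpha>\<close>, the infimum in \<open>T\<^sup>P\<close> is that value of \<open>F\<close>, and, as \<open>T\<^sup>P\<close> depends
  on the parameters only through \<open>y\<close>, one may take mean 0, deviation 1 and \<open>u = y\<close>.

  For the coverage bound, under any law \<open>p\<close> on the naturals the values whose strictly more likely
  competitors have total mass at most \<open>\<alpha>\<close> carry mass at least \<open>\<alpha>\<close>. Apply this to the conditional law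
  of the estimator given \<open>(A, B)\<close> for the true membership matrix and integrate.
\<close>

section \<open>Mass of the strictly more likely values under a discrete law\<close>

definition prob_more_likely :: "'a pmf \<Rightarrow> 'a \<Rightarrow> real" where
  "prob_more_likely p w = measure_pmf.prob p {k. pmf p w < pmf p k}"

text \<open>Reading the unordered sum as a probability makes the monotonicity and additivity of
  measures available.\<close>

lemma F_more_likely_eq: "F_more_likely P w a b = prob_more_likely (P a b) w"
  unfolding F_more_likely_def prob_more_likely_def measure_pmf_conv_infsetsum
  by (rule infsetsum_infsum[symmetric]) (rule pmf_abs_summable)

text \<open>The total mass is 1, so at most 1/c values can have mass c or more. Hence a nonempty set
  of values whose masses stay away from 0 has a most likely element.\<close>

lemma finite_pmf_ge:
  assumes "0 < c"
  shows "finite {k. c \<le> pmf p k}"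
proof (rule ccontr)
  assume "infinite {k. c \<le> pmf p k}"
  moreover obtain m :: nat where m: "1 < real m * c"
    using reals_Archimedean3[OF assms] by blast
  ultimately obtain T where T: "finite T" "card T = m" "T \<subseteq> {k. c \<le> pmf p k}"
    using infinite_arbitrarily_large by blast
  have "real m * c \<le> sum (pmf p) T"
    using sum_bounded_below[of T c "pmf p"] T by auto
  also have "\<dots> = measure_pmf.prob p T"
    using T(1) by (simp add: measure_measure_pmf_finite)
  also have "\<dots> \<le> 1"
    by simp
  finally show False
    using m by simp
qed

text \<open>Going through the values in decreasing order of probability, rejection starts only once
  the mass already collected exceeds \<alpha>.\<close>

lemma prob_prob_more_likely_le:
  fixes p :: "'a pmf"
  assumes "\<alpha> \<le> 1"
  shows "\<alpha> \<le> measure_pmf.prob p {w. prob_more_likely p w \<le> \<alpha>}"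
proof (cases "\<forall>w\<in>set_pmf p. prob_more_likely p w \<le> \<alpha>")
  case True
  then have "measure_pmf.prob p {w. prob_more_likely p w \<le> \<alpha>} = 1"
    by (subst measure_pmf.prob_eq_1) (auto simp: AE_measure_pmf_iff)
  then show ?thesis
    using assms by simp
next
  case False
  then obtain w\<^sub>0 where w\<^sub>0: "0 < pmf p w\<^sub>0" "\<alpha> < prob_more_likely p w\<^sub>0"
    by (meson not_le pmf_positive)
  \<comment> \<open>Everything strictly more likely than the most likely rejected value is accepted, and has mass above \<open>\<alpha>\<close>.\<close>
  define S where "S = {k. pmf p w\<^sub>0 \<le> pmf p k \<and> \<alpha> < prob_more_likely p k}"
  \<comment> \<open>The positive mass of \<open>w\<^sub>0\<close> bounds the masses in
    \<open>S\<close> away from 0.\<close>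
  have "finite S" "w\<^sub>0 \<in> S"
    using w\<^sub>0 finite_subset[OF _ finite_pmf_ge[OF w\<^sub>0(1), of p]] by (auto simp: S_def)
  then have "Max (pmf p ` S) \<in> pmf p ` S"
    by (intro Max_in) auto
  then obtain w where "w \<in> S" "Max (pmf p ` S) = pmf p w"
    by (rule imageE) metis
  then have w: "w \<in> S" "\<And>k. k \<in> S \<Longrightarrow> pmf p k \<le> pmf p w"
    using Max_ge[of "pmf p ` S"] \<open>finite S\<close> by auto
  have "{k. pmf p w < pmf p k} \<subseteq> {k. prob_more_likely p k \<le> \<alpha>}"
  proof (intro subsetI CollectI, rule ccontr)
    fix k assume "k \<in> {k. pmf p w < pmf p k}" "\<not> prob_more_likely p k \<le> \<alpha>"
    with w(1) have "k \<in> S" "pmf p w < pmf p k"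
      by (auto simp: S_def)
    then show False
      using w(2)[of k] by simp
  qed
  then have "prob_more_likely p w \<le> measure_pmf.prob p {k. prob_more_likely p k \<le> \<alpha>}"
    unfolding prob_more_likely_def by (intro measure_pmf.finite_measure_mono) auto
  then show ?thesis
    using w(1) by (simp add: S_def)
qed

section \<open>Integrating the mass bound over a conditional law\<close>

text \<open>As a series, the measure can be treated term by term, both for measurability in a
  parameter and for exchange with an integral.\<close>

lemma emeasure_pmf_nat: "emeasure (measure_pmf p) A = (\<Sum>k::nat. ennreal (pmf p k) * indicator A k)"
proof -
  have "emeasure (measure_pmf p) A = (\<integral>\<^sup>+k. indicator A k \<partial>measure_pmf p)"
    by simp
  also have "\<dots> = (\<integral>\<^sup>+k. ennreal (pmf p k) * indicator A k \<partial>count_space UNIV)"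
    by (rule nn_integral_measure_pmf)
  finally show ?thesis
    by (simp add: nn_integral_count_space_nat)
qed

text \<open>The set being measured moves with \<open>s\<close>. In the series form each term is a
  measurable weight times the indicator of a comparison of two measurable functions.\<close>

lemma borel_measurable_prob_more_likely:
  fixes Q :: "'s \<Rightarrow> nat pmf"
  assumes [measurable]: "\<And>k. (\<lambda>s. pmf (Q s) k) \<in> borel_measurable S"
  shows "(\<lambda>s. prob_more_likely (Q s) w) \<in> borel_measurable S"
proof -
  have "(\<lambda>s. enn2real (\<Sum>k. ennreal (pmf (Q s) k) * indicator {s. pmf (Q s) w < pmf (Q s) k} s))
    \<in> borel_measurable S"
    by measurable
  then show ?thesis
    by (simp add: prob_more_likely_def measure_def emeasure_pmf_nat indicator_def)
qed

text \<open>Whether a value is accepted is decided by \<open>AB\<close> alone, so on that event the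
  indicator of \<open>W u = k\<close> may be replaced by its conditional probability. Summing over
  \<open>k\<close> gives the expected conditional mass of the accepted values, which is at least
  \<alpha> pointwise.\<close>

lemma (in prob_space) prob_more_likely_cond_law_le:
  fixes Q :: "'s \<Rightarrow> nat pmf" and W :: "'a \<Rightarrow> nat"
  assumes AB[measurable]: "AB \<in> M \<rightarrow>\<^sub>M S" and W[measurable]: "W \<in> M \<rightarrow>\<^sub>M count_space UNIV"
    and Q[measurable]: "\<And>k. (\<lambda>s. pmf (Q s) k) \<in> borel_measurable S"
    and law: "\<And>k. AE u in M. pmf (Q (AB u)) k =
      real_cond_exp M (vimage_algebra (space M) AB S) (indicator {u \<in> space M. W u = k}) u"
    and "0 \<le> \<alpha>" "\<alpha> \<le> 1"
  shows "\<alpha> \<le> prob {u \<in> space M. prob_more_likely (Q (AB u)) (W u) \<le> \<alpha>}"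
proof -
  define F where "F = vimage_algebra (space M) AB S"
  have AB_space: "AB \<in> space M \<rightarrow> space S"
    using AB by (rule measurable_space[THEN funcsetI])
  have [measurable]: "AB \<in> F \<rightarrow>\<^sub>M S"
    unfolding F_def using AB_space by (rule measurable_vimage_algebra1)
  interpret finite_measure_subalgebra M F
  proof
    show "subalgebra M F"
      unfolding subalgebra_def F_def by (auto simp: sets_vimage_algebra2[OF AB_space] intro: measurable_sets[OF AB])
  qed
  note [measurable] = borel_measurable_prob_more_likely[of Q S, OF Q]
  \<comment> \<open>\<open>E k\<close> says that \<open>k\<close> is observed and accepted,
    \<open>D k\<close> that \<open>k\<close> would be accepted. The latter depends on
    \<open>AB u\<close> only, so its indicator is measurable for the subalgebra
    \<open>F\<close>.\<close>
  define E where "E k = {u \<in> space M. prob_more_likely (Q (AB u)) k \<le> \<alpha> \<and> W u = k}" for k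
  define D where "D k = {u. prob_more_likely (Q (AB u)) k \<le> \<alpha>}" for k
  have E[measurable]: "E k \<in> events" for k
    unfolding E_def by measurable
  have D[measurable]: "indicat_real (D k) \<in> borel_measurable F" "indicat_real (D k) \<in> borel_measurable M" for k
    unfolding D_def by measurable
  have E_eq: "emeasure M (E k) = (\<integral>\<^sup>+u. ennreal (pmf (Q (AB u)) k) * indicator (D k) u \<partial>M)" for k
  proof -
    let ?W = "indicator {u \<in> space M. W u = k} :: 'a \<Rightarrow> real"
    have EW: "indicat_real (E k) u = indicator (D k) u * ?W u" for u
      by (auto simp: E_def D_def indicator_def)
    have int: "integrable M (\<lambda>u. indicator (D k) u * ?W u)"
      unfolding EW[symmetric] by (rule integrable_const_bound[of _ 1]) auto
    have W': "?W \<in> borel_measurable M"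
      by measurable
    have "prob (E k) = (\<integral>u. indicator (D k) u * ?W u \<partial>M)"
      unfolding EW[symmetric] using E[of k] sets.sets_into_space[OF E[of k]] by simp
    \<comment> \<open>Defining property of the conditional expectation, tested against an
      \<open>F\<close>-measurable factor.\<close>
    also have "\<dots> = (\<integral>u. indicator (D k) u * real_cond_exp M F ?W u \<partial>M)"
      using real_cond_exp_intg(2)[OF int D(1) W'] by simp
    also have "\<dots> = (\<integral>u. indicator (D k) u * pmf (Q (AB u)) k \<partial>M)"
      by (rule integral_cong_AE) (use law[of k] in \<open>auto simp: F_def[symmetric]\<close>)
    finally have "emeasure M (E k) = ennreal (\<integral>u. indicator (D k) u * pmf (Q (AB u)) k \<partial>M)"
      by (simp add: emeasure_eq_measure)
    \<comment> \<open>Nonnegative integrals allow the later exchange with the sum over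
      \<open>k\<close> without an integrability condition.\<close>
    also have "\<dots> = (\<integral>\<^sup>+u. ennreal (indicator (D k) u * pmf (Q (AB u)) k) \<partial>M)"
    proof (rule nn_integral_eq_integral[symmetric])
      show "integrable M (\<lambda>u. indicator (D k) u * pmf (Q (AB u)) k)"
        by (rule integrable_const_bound[of _ 1]) (simp_all add: pmf_le_1 mult_le_one)
    qed auto
    also have "\<dots> = (\<integral>\<^sup>+u. ennreal (pmf (Q (AB u)) k) * indicator (D k) u \<partial>M)"
      by (rule nn_integral_cong) (auto simp: indicator_def)
    finally show ?thesis .
  qed
  have "ennreal \<alpha> = (\<integral>\<^sup>+u. ennreal \<alpha> \<partial>M)"
    by (simp add: emeasure_space_1)
  also have "\<dots> \<le> (\<integral>\<^sup>+u. emeasure (measure_pmf (Q (AB u))) {k. prob_more_likely (Q (AB u)) k \<le> \<alpha>} \<partial>M)"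
    using prob_prob_more_likely_le[OF \<open>\<alpha> \<le> 1\<close>]
    by (intro nn_integral_mono) (simp add: measure_pmf.emeasure_eq_measure ennreal_leI)
  also have "\<dots> = (\<integral>\<^sup>+u. (\<Sum>k. ennreal (pmf (Q (AB u)) k) * indicator (D k) u) \<partial>M)"
    by (simp add: emeasure_pmf_nat D_def indicator_def)
  also have "\<dots> = (\<Sum>k. emeasure M (E k))"
    unfolding E_eq by (rule nn_integral_suminf) (unfold D_def, measurable)
  also have "\<dots> = emeasure M (\<Union>k. E k)"
    by (rule suminf_emeasure) (auto simp: disjoint_family_on_def E_def)
  also have "(\<Union>k. E k) = {u \<in> space M. prob_more_likely (Q (AB u)) (W u) \<le> \<alpha>}"
    by (auto simp: E_def)
  finally show ?thesis
    by (simp add: emeasure_eq_measure)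
qed

section \<open>Diagonal matrices, norms, binary matrices and index enumeration\<close>

lemma dim_mat_diag [simp]: "dim_row (mat_diag n f) = n" "dim_col (mat_diag n f) = n"
  by (simp_all add: mat_diag_def)

lemma mat_diag_mult_vec:
  assumes "u \<in> carrier_vec n" "i < n"
  shows "(mat_diag n f *\<^sub>v u) $ i = f i * u $ i"
proof -
  have "(mat_diag n f *\<^sub>v u) $ i = (\<Sum>j<n. (if i = j then f j else 0) * u $ j)"
    using assms by (simp add: mat_diag_def scalar_prod_def lessThan_atLeast0)
  also have "\<dots> = (\<Sum>j<n. if j = i then f i * u $ i else 0)"
    by (intro sum.cong) auto
  finally show ?thesis
    using assms by simp
qed

lemma mixture_data_index:
  assumes "M \<in> carrier_mat n \<tau>" "u \<in> carrier_vec n" "i < n"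
  shows "mixture_data n M \<mu> \<sigma> u $ i = (M *\<^sub>v \<mu>) $ i + (M *\<^sub>v \<sigma>) $ i * u $ i"
  using assms mat_diag_mult_vec[OF assms(2,3)]
  by (simp add: mixture_data_def del: index_mult_mat_vec)

lemma mixture_data_carrier:
  assumes "M \<in> carrier_mat n \<tau>"
  shows "mixture_data n M \<mu> \<sigma> u \<in> carrier_vec n"
  using assms by (intro carrier_vecI) (simp add: mixture_data_def)

text \<open>Serves the convention 0/0 = 0: a residual of norm zero vanishes entrywise.\<close>

lemma euclid_norm_eq_0D:
  assumes "euclid_norm v = 0" "i < dim_vec v"
  shows "v $ i = 0"
proof -
  have "(\<Sum>j\<in>{0..<dim_vec v}. v $ j * v $ j) = 0"
    using assms(1) by (simp add: euclid_norm_def scalar_prod_def)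
  then have "v $ i * v $ i = 0"
    using assms(2) by (subst (asm) sum_nonneg_eq_0_iff) auto
  then show ?thesis
    by simp
qed

text \<open>Such a matrix is determined by its entry function on a finite index set;
  \<open>restrict\<close> places that function in the extensional function space.\<close>

lemma finite_binary_mats:
  "finite {M :: 'a :: zero_neq_one mat. M \<in> carrier_mat n m \<and> (\<forall>i<n. \<forall>k<m. M $$ (i, k) \<in> {0, 1})}"
    (is "finite ?S")
proof (rule finite_subset)
  show "?S \<subseteq> (\<lambda>f. mat n m f) ` (({..<n} \<times> {..<m}) \<rightarrow>\<^sub>E {0, 1})"
  proof
    fix M :: "'a mat" assume M: "M \<in> ?S"
    then have "M = mat n m (restrict (($$) M) ({..<n} \<times> {..<m}))"
      by (intro eq_matI) auto
    moreover have "restrict (($$) M) ({..<n} \<times> {..<m}) \<in> ({..<n} \<times> {..<m}) \<rightarrow>\<^sub>E {0, 1}"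
      using M by auto
    ultimately show "M \<in> (\<lambda>f. mat n m f) ` (({..<n} \<times> {..<m}) \<rightarrow>\<^sub>E {0, 1})"
      by blast
  qed
qed (auto intro!: finite_imageI finite_PiE)

text \<open>Makes the \<open>Min\<close> in \<open>T_profile\<close> meaningful and, later, the
  union of events over all membership matrices measurable.\<close>

lemma finite_membership_mats: "finite {M. membership_mat n \<tau> M}"
  by (rule finite_subset[OF _ finite_binary_mats[of n \<tau>]]) (auto simp: membership_mat_def)

text \<open>\<open>pick I\<close> enumerates \<open>I\<close> increasingly, and the position of an
  element is the number of smaller elements.\<close>

lemma sum_pick:
  assumes "finite I"
  shows "(\<Sum>s<card I. f (pick I s)) = sum f I"
proof (rule sum.reindex_bij_witness[of _ "\<lambda>i. card {a \<in> I. a < i}" "pick I"])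
  fix i assume "i \<in> I"
  then show "pick I (card {a \<in> I. a < i}) = i"
    by (rule pick_card_in_set)
  have "{a \<in> I. a < i} \<subset> I"
    using \<open>i \<in> I\<close> by auto
  then show "card {a \<in> I. a < i} \<in> {..<card I}"
    using psubset_card_mono[OF assms] by simp
qed (auto simp: card_pick pick_in_set)

section \<open>Hat matrix and statistics of a membership matrix\<close>

text \<open>The same description as that of the index \<open>k\<close> in \<open>stat_C\<close>, so
  that definition can be folded.\<close>

definition component_of :: "nat \<Rightarrow> real mat \<Rightarrow> nat \<Rightarrow> nat" where
  "component_of \<tau> M i = (THE k. k < \<tau> \<and> M $$ (i, k) = 1)"

context
  fixes n \<tau> :: nat and M :: "real mat"
  assumes M: "membership_mat n \<tau> M"
begin

lemma membership_carrier: "M \<in> carrier_mat n \<tau>"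
  using M by (simp add: membership_mat_def)

lemma component_of:
  assumes "i < n"
  shows "component_of \<tau> M i < \<tau>" "M $$ (i, component_of \<tau> M i) = 1"
proof -
  have "\<exists>!k. k < \<tau> \<and> M $$ (i, k) = 1"
    using M assms by (simp add: membership_mat_def)
  then have "component_of \<tau> M i < \<tau> \<and> M $$ (i, component_of \<tau> M i) = 1"
    unfolding component_of_def by (rule theI')
  then show "component_of \<tau> M i < \<tau>" "M $$ (i, component_of \<tau> M i) = 1"
    by auto
qed

lemma membership_entry:
  assumes "i < n" "k < \<tau>"
  shows "M $$ (i, k) = (if k = component_of \<tau> M i then 1 else 0)"
proof -
  have "M $$ (i, k) \<in> {0, 1}" "\<exists>!k. k < \<tau> \<and> M $$ (i, k) = 1"
    using M assms by (auto simp: membership_mat_def)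
  then show ?thesis
    using component_of[OF assms(1)] assms(2) by auto
qed

lemma component_indices_eq:
  assumes "k < \<tau>"
  shows "component_indices n M k = {i \<in> {..<n}. component_of \<tau> M i = k}"
  using assms by (auto simp: component_indices_def membership_entry split: if_splits)

lemma finite_component_indices: "finite (component_indices n M k)"
  by (simp add: component_indices_def)

lemma membership_mult_vec:
  assumes "v \<in> carrier_vec \<tau>" "i < n"
  shows "(M *\<^sub>v v) $ i = v $ component_of \<tau> M i"
proof -
  have "(M *\<^sub>v v) $ i = (\<Sum>k<\<tau>. M $$ (i, k) * v $ k)"
    using assms membership_carrier by (simp add: scalar_prod_def lessThan_atLeast0)
  also have "\<dots> = (\<Sum>k<\<tau>. if k = component_of \<tau> M i then v $ k else 0)"
    using assms by (intro sum.cong) (auto simp: membership_entry)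
  finally show ?thesis
    using component_of[OF assms(2)] by simp
qed

text \<open>Each row has a single 1, so distinct columns have disjoint supports, and a column paired
  with itself counts its component.\<close>

lemma gram_eq: "M\<^sup>T * M = mat_diag \<tau> (\<lambda>k. real (card (component_indices n M k)))"
proof (rule eq_matI)
  fix j k assume "j < dim_row (mat_diag \<tau> (\<lambda>k. real (card (component_indices n M k))))"
    and "k < dim_col (mat_diag \<tau> (\<lambda>k. real (card (component_indices n M k))))"
  then have jk: "j < \<tau>" "k < \<tau>"
    by (auto simp: mat_diag_def)
  have "(M\<^sup>T * M) $$ (j, k) = (\<Sum>i<n. M $$ (i, j) * M $$ (i, k))"
    using jk membership_carrier by (simp add: scalar_prod_def lessThan_atLeast0)
  also have "\<dots> = (\<Sum>i\<in>{i \<in> {..<n}. component_of \<tau> M i = k}. if j = k then 1 else 0)"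
    using jk by (subst sum.inter_filter) (auto simp: membership_entry intro!: sum.cong sum.neutral)
  finally show "(M\<^sup>T * M) $$ (j, k) = mat_diag \<tau> (\<lambda>k. real (card (component_indices n M k))) $$ (j, k)"
    using jk by (simp add: mat_diag_def component_indices_eq)
qed (use membership_carrier in \<open>auto simp: mat_diag_def\<close>)

text \<open>An empty component would give the Gram matrix a zero row, and so a zero row in its
  product with an inverse.\<close>

lemma card_component_indices_pos:
  assumes "k < \<tau>"
  shows "0 < card (component_indices n M k)"
proof (rule ccontr)
  let ?G = "mat_diag \<tau> (\<lambda>k. real (card (component_indices n M k)))"
  assume c: "\<not> ?thesis"
  obtain B where B: "?G * B = 1\<^sub>m \<tau>" "B * ?G = 1\<^sub>m (dim_row B)"
    using M unfolding membership_mat_def gram_eq invertible_mat_def inverts_mat_def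
    by (auto simp: mat_diag_def)
  \<comment> \<open>\<open>inverts_mat\<close> does not state the dimensions of \<open>B\<close>;
    they are read off from the two products.\<close>
  have "dim_col B = \<tau>"
    using arg_cong[OF B(1), of dim_col] by simp
  moreover have "dim_row B = \<tau>"
    using arg_cong[OF B(2), of dim_col] by (simp add: mat_diag_def)
  ultimately have "B \<in> carrier_mat \<tau> \<tau>"
    by auto
  then have "(?G * B) $$ (k, k) = 0"
    using c assms by (subst mat_diag_mult_left) auto
  then show False
    using assms by (simp add: B)
qed

text \<open>\<open>mat_inverse\<close> returns an option. The explicit inverse shows that it
  succeeds, and uniqueness of inverses identifies the result.\<close>

lemma gram_inverse_eq: "gram_inverse M = mat_diag \<tau> (\<lambda>k. 1 / real (card (component_indices n M k)))"
proof -
  let ?G = "mat_diag \<tau> (\<lambda>k. real (card (component_indices n M k)))"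
  let ?H = "mat_diag \<tau> (\<lambda>k. 1 / real (card (component_indices n M k)))"
  have nz: "card (component_indices n M k) \<noteq> 0" if "k < \<tau>" for k
    using card_component_indices_pos[OF that] by simp
  have HG: "?H * ?G = 1\<^sub>m \<tau>" and GH: "?G * ?H = 1\<^sub>m \<tau>"
    unfolding mat_diag_diag by (auto simp: mat_diag_def nz intro!: eq_matI)
  have "?G \<in> Units (ring_mat TYPE(real) \<tau> ())"
    unfolding Units_def ring_mat_def using HG GH by (auto intro!: bexI[of _ ?H])
  then obtain B where B: "mat_inverse ?G = Some B"
    using mat_inverse(1)[OF mat_diag_dim, where b = "()"] by (cases "mat_inverse ?G") auto
  have B': "?G * B = 1\<^sub>m \<tau>" "B \<in> carrier_mat \<tau> \<tau>"
    using mat_inverse(2)[OF mat_diag_dim B] by auto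
  have "B = (?H * ?G) * B"
    unfolding HG using B' by simp
  also have "\<dots> = ?H * (?G * B)"
    using B' by (intro assoc_mult_mat[of _ \<tau> \<tau> _ \<tau> _ \<tau>]) auto
  also have "\<dots> = ?H"
    unfolding B' by (intro right_mult_one_mat) auto
  finally show ?thesis
    by (simp add: gram_inverse_def gram_eq B)
qed

lemma hat_mat_carrier: "hat_mat M \<in> carrier_mat n n"
  using membership_carrier by (auto simp: hat_mat_def gram_inverse_eq)

text \<open>Only the column of the common component contributes, so the diagonal block of a
  component is the averaging matrix.\<close>

lemma hat_mat_index:
  assumes "k < \<tau>" "i \<in> component_indices n M k" "j \<in> component_indices n M k"
  shows "hat_mat M $$ (i, j) = 1 / real (card (component_indices n M k))"
proof -
  have ij: "i < n" "j < n" "component_of \<tau> M i = k" "component_of \<tau> M j = k"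
    using assms by (auto simp: component_indices_eq)
  have "hat_mat M $$ (i, j) =
      (\<Sum>l<\<tau>. M $$ (i, l) * (1 / real (card (component_indices n M l))) * M $$ (j, l))"
    unfolding hat_mat_def gram_inverse_eq mat_diag_mult_right[OF membership_carrier]
    using ij membership_carrier by (simp add: scalar_prod_def lessThan_atLeast0)
  also have "\<dots> = (\<Sum>l<\<tau>. if l = k then 1 / real (card (component_indices n M l)) else 0)"
    using ij by (intro sum.cong) (auto simp: membership_entry)
  finally show ?thesis
    using assms(1) by simp
qed

lemma stat_A_carrier: "stat_A M y \<in> carrier_vec \<tau>"
  by (intro carrier_vecI) (simp add: stat_A_def gram_inverse_eq)

lemma stat_A_index:
  assumes "y \<in> carrier_vec n" "k < \<tau>"
  shows "stat_A M y $ k = (\<Sum>j\<in>component_indices n M k. y $ j) / real (card (component_indices n M k))"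
proof -
  have "stat_A M y $ k = (\<Sum>j<n. 1 / real (card (component_indices n M k)) * M $$ (j, k) * y $ j)"
    using assms membership_carrier
    by (simp add: stat_A_def gram_inverse_eq mat_diag_mult_left[of _ _ n] scalar_prod_def lessThan_atLeast0)
  also have "\<dots> = (\<Sum>j\<in>{j \<in> {..<n}. component_of \<tau> M j = k}. y $ j / real (card (component_indices n M k)))"
    using assms by (subst sum.inter_filter) (auto simp: membership_entry intro!: sum.cong)
  finally show ?thesis
    using assms by (simp add: component_indices_eq sum_divide_distrib)
qed

lemma dim_component_residual: "dim_vec (component_residual n M k y) = card (component_indices n M k)"
  using hat_mat_carrier
  by (auto simp: component_residual_def Let_def dim_submatrix component_indices_def intro!: arg_cong[of _ _ card])

text \<open>The block of the hat matrix averages, so the residual is the deviation from the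
  component mean.\<close>

lemma component_residual_index:
  assumes y: "y \<in> carrier_vec n" and k: "k < \<tau>" and r: "r < card (component_indices n M k)"
  shows "component_residual n M k y $ r = y $ pick (component_indices n M k) r - stat_A M y $ k"
proof -
  define I where "I = component_indices n M k"
  have I: "{i. i < n \<and> i \<in> I} = I" "finite I"
    by (auto simp: I_def component_indices_def)
  have pick: "pick I s \<in> I" if "s < card I" for s
    using that by (simp add: pick_in_set)
  have H: "submatrix (hat_mat M) I I $$ (r, s) = 1 / real (card I)" if "s < card I" for s
    using that r hat_mat_carrier pick hat_mat_index[OF k] unfolding I_def[symmetric]
    by (subst submatrix_index) (auto simp: I)
  have "component_residual n M k y $ r =
      (\<Sum>s<card I. ((if r = s then 1 else 0) - 1 / real (card I)) * y $ pick I s)"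
    using r y hat_mat_carrier H unfolding component_residual_def I_def[symmetric]
    by (simp add: I subvec_def scalar_prod_def dim_submatrix lessThan_atLeast0)
  also have "\<dots> = (\<Sum>s<card I. (if s = r then y $ pick I s else 0) - y $ pick I s / real (card I))"
    by (intro sum.cong) (auto simp: algebra_simps)
  also have "\<dots> = y $ pick I r - (\<Sum>s<card I. y $ pick I s) / real (card I)"
    using r unfolding I_def[symmetric] by (simp add: sum_subtractf sum_divide_distrib)
  also have "(\<Sum>s<card I. y $ pick I s) = (\<Sum>j\<in>I. y $ j)"
    by (rule sum_pick[OF I(2)])
  finally show ?thesis
    by (simp add: stat_A_index[OF y k] I_def)
qed

lemma stat_B_carrier: "stat_B n \<tau> M y \<in> carrier_vec \<tau>"
  by (simp add: stat_B_def)

text \<open>Coordinate form from which measurability is read off.\<close>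

lemma stat_B_index:
  assumes "y \<in> carrier_vec n" "k < \<tau>"
  shows "stat_B n \<tau> M y $ k =
    sqrt (\<Sum>r<card (component_indices n M k). (y $ pick (component_indices n M k) r - stat_A M y $ k)\<^sup>2)"
  using assms
  by (simp add: stat_B_def euclid_norm_def scalar_prod_def dim_component_residual lessThan_atLeast0
      component_residual_index power2_eq_square)

text \<open>Each observation is its component mean plus its residual, and the residual is its norm
  times its direction.\<close>

lemma mixture_data_stat:
  assumes y: "y \<in> carrier_vec n"
  shows "mixture_data n M (stat_A M y) (stat_B n \<tau> M y) (stat_C n \<tau> M y) = y"
proof (rule eq_vecI)
  fix i assume "i < dim_vec y"
  then have i: "i < n"
    using y by simp
  define k where "k = component_of \<tau> M i"
  define I where "I = component_indices n M k"
  define r where "r = component_residual n M k y"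
  \<comment> \<open>Position of observation \<open>i\<close> in the subvector of its
    component.\<close>
  define s where "s = card {j \<in> I. j < i}"
  have k: "k < \<tau>"
    using component_of[OF i] by (simp add: k_def)
  have iI: "i \<in> I"
    using i k by (simp add: I_def component_indices_eq k_def)
  then have "{j \<in> I. j < i} \<subset> I"
    by auto
  then have s: "s < card I"
    unfolding s_def I_def by (rule psubset_card_mono[OF finite_component_indices])
  have C: "stat_C n \<tau> M y $ i = inverse (euclid_norm r) * r $ s"
    using i s dim_component_residual[of k y]
    by (simp add: stat_C_def Let_def component_of_def[symmetric] k_def[symmetric] r_def s_def I_def)
  have "mixture_data n M (stat_A M y) (stat_B n \<tau> M y) (stat_C n \<tau> M y) $ i =
      stat_A M y $ k + euclid_norm r * (inverse (euclid_norm r) * r $ s)"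
    using i k C
    by (subst mixture_data_index[OF membership_carrier])
      (simp_all add: stat_C_def stat_B_def membership_mult_vec stat_A_carrier k_def[symmetric] r_def
        del: index_mult_mat_vec)
  \<comment> \<open>If the norm is 0, the left side is 0 and so is the residual, hence the
    cancellation holds here too.\<close>
  also have "euclid_norm r * (inverse (euclid_norm r) * r $ s) = r $ s"
    using euclid_norm_eq_0D[of r s] s dim_component_residual[of k y]
    by (cases "euclid_norm r = 0") (auto simp: r_def I_def)
  also have "r $ s = y $ i - stat_A M y $ k"
    using s component_residual_index[OF y k, of s] pick_card_in_set[OF iI] unfolding r_def I_def s_def
    by simp
  finally show "mixture_data n M (stat_A M y) (stat_B n \<tau> M y) (stat_C n \<tau> M y) $ i = y $ i"
    by simp
qed (use y mixture_data_carrier[OF membership_carrier] in auto)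

text \<open>Supplies the witness for \<open>Xi_set\<close>: any data vector arises from mean 0 and
  deviation 1 with the data themselves as noise.\<close>

lemma mixture_data_standard:
  assumes "y \<in> carrier_vec n"
  shows "mixture_data n M (0\<^sub>v \<tau>) (vec \<tau> (\<lambda>_. 1)) y = y"
proof (rule eq_vecI)
  fix i assume "i < dim_vec y"
  then have "i < n"
    using assms by simp
  then show "mixture_data n M (0\<^sub>v \<tau>) (vec \<tau> (\<lambda>_. 1)) y $ i = y $ i"
    using component_of(1)[of i]
    by (simp add: mixture_data_index[OF membership_carrier assms] membership_mult_vec del: index_mult_mat_vec)
qed (use assms mixture_data_carrier[OF membership_carrier] in auto)

text \<open>The vector at which \<open>B_region\<close> evaluates the estimator is the original
  \<open>y\<close>, by the reconstruction identity.\<close>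

lemma Gamma_set_iff:
  assumes "y \<in> carrier_vec n"
  shows "(\<tau>, M) \<in> Gamma_set n tauhat P \<alpha> y \<longleftrightarrow>
    F_more_likely (P \<tau> M) (tauhat y) (stat_A M y) (stat_B n \<tau> M y) \<le> \<alpha>"
  using M mixture_data_stat[OF assms] stat_A_carrier
  by (auto simp: Gamma_set_def B_region_def stat_B_def stat_C_def)

end

section \<open>The profile statistic and the form of the confidence set\<close>

text \<open>For each \<open>M'\<close> the admissible levels form a closed half-line starting at the
  value of \<open>F_more_likely\<close>, which is therefore the infimum. The minimum is over a
  finite set, nonempty because it contains \<open>M\<close>.\<close>

lemma T_profile_le_iff:
  assumes "membership_mat n \<tau> M"
  shows "T_profile n tauhat P u \<tau> M \<mu> \<sigma> \<le> \<alpha> \<longleftrightarrow>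
    (\<exists>M'. membership_mat n \<tau> M' \<and>
      F_more_likely (P \<tau> M') (tauhat (mixture_data n M \<mu> \<sigma> u))
        (stat_A M' (mixture_data n M \<mu> \<sigma> u)) (stat_B n \<tau> M' (mixture_data n M \<mu> \<sigma> u)) \<le> \<alpha>)"
proof -
  define y where "y = mixture_data n M \<mu> \<sigma> u"
  have y: "y \<in> carrier_vec n"
    unfolding y_def by (rule mixture_data_carrier[OF membership_carrier[OF assms]])
  have T: "T_profile n tauhat P u \<tau> M \<mu> \<sigma> =
      Min ((\<lambda>M'. F_more_likely (P \<tau> M') (tauhat y) (stat_A M' y) (stat_B n \<tau> M' y)) ` {M'. membership_mat n \<tau> M'})"
    unfolding T_profile_def y_def[symmetric]
    by (intro arg_cong[of _ _ Min] image_cong refl) (simp add: Gamma_set_iff[OF _ y] atLeast_def[symmetric])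
  show ?thesis
    unfolding T y_def[symmetric] using assms finite_membership_mats[of n \<tau>] by (subst Min_le_iff) auto
qed

lemma Xi_set_eq:
  assumes "y \<in> carrier_vec n"
  shows "Xi_set n tauhat P \<alpha> y = {\<tau>. \<exists>M. membership_mat n \<tau> M \<and>
    F_more_likely (P \<tau> M) (tauhat y) (stat_A M y) (stat_B n \<tau> M y) \<le> \<alpha>}"
proof (rule equalityI; rule subsetI)
  fix \<tau> assume "\<tau> \<in> Xi_set n tauhat P \<alpha> y"
  then show "\<tau> \<in> {\<tau>. \<exists>M. membership_mat n \<tau> M \<and>
      F_more_likely (P \<tau> M) (tauhat y) (stat_A M y) (stat_B n \<tau> M y) \<le> \<alpha>}"
    by (auto simp: Xi_set_def mixture_param_def T_profile_le_iff)
next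
  fix \<tau> assume "\<tau> \<in> {\<tau>. \<exists>M. membership_mat n \<tau> M \<and>
      F_more_likely (P \<tau> M) (tauhat y) (stat_A M y) (stat_B n \<tau> M y) \<le> \<alpha>}"
  then obtain M where M: "membership_mat n \<tau> M"
    and F: "F_more_likely (P \<tau> M) (tauhat y) (stat_A M y) (stat_B n \<tau> M y) \<le> \<alpha>"
    by auto
  have "T_profile n tauhat P y \<tau> M (0\<^sub>v \<tau>) (vec \<tau> (\<lambda>_. 1)) \<le> \<alpha>"
    using F M unfolding T_profile_le_iff[OF M] mixture_data_standard[OF M assms] by blast
  moreover have "mixture_param n \<tau> M (0\<^sub>v \<tau>) (vec \<tau> (\<lambda>_. 1))"
    using M by (simp add: mixture_param_def)
  ultimately show "\<tau> \<in> Xi_set n tauhat P \<alpha> y"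
    unfolding Xi_set_def using assms mixture_data_standard[OF M assms, symmetric] by blast
qed

section \<open>Measurability of the data, the statistics and the acceptance value\<close>

lemma space_vec_borel [simp]: "space (vec_borel n) = carrier_vec n"
  by (simp add: vec_borel_def)

lemma borel_measurable_vec_index:
  assumes "i < n"
  shows "(\<lambda>v. v $ i) \<in> borel_measurable (vec_borel n)"
proof -
  have "(\<lambda>v. \<lambda>i\<in>{..<n}. v $ i) \<in> vec_borel n \<rightarrow>\<^sub>M (\<Pi>\<^sub>M i\<in>{..<n}. borel :: real measure)"
    unfolding vec_borel_def by (rule measurable_vimage_algebra1) (auto simp: space_PiM)
  then have "(\<lambda>v. (\<lambda>i\<in>{..<n}. v $ i) i) \<in> borel_measurable (vec_borel n)"
    by (rule measurable_compose[OF _ measurable_component_singleton]) (use assms in simp)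
  then show ?thesis
    using assms by simp
qed

text \<open>\<open>vec_borel\<close> is pulled back from the product space along the
  coordinates.\<close>

lemma measurable_vec_borelI:
  assumes "\<And>x. x \<in> space N \<Longrightarrow> f x \<in> carrier_vec n"
    and "\<And>i. i < n \<Longrightarrow> (\<lambda>x. f x $ i) \<in> borel_measurable N"
  shows "f \<in> N \<rightarrow>\<^sub>M vec_borel n"
  unfolding vec_borel_def
  by (rule measurable_vimage_algebra2) (use assms in \<open>auto intro!: measurable_restrict\<close>)

lemma measurable_mixture_data:
  assumes "M \<in> carrier_mat n \<tau>"
  shows "mixture_data n M \<mu> \<sigma> \<in> vec_borel n \<rightarrow>\<^sub>M vec_borel n"
proof (rule measurable_vec_borelI)
  fix i assume i: "i < n"
  have "(\<lambda>u. (M *\<^sub>v \<mu>) $ i + (M *\<^sub>v \<sigma>) $ i * u $ i) \<in> borel_measurable (vec_borel n)"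
    using borel_measurable_vec_index[OF i] by (intro borel_measurable_add borel_measurable_times) auto
  \<comment> \<open>The coordinate formula holds for vectors of dimension \<open>n\<close>, that is,
    on the space of \<open>vec_borel n\<close>.\<close>
  then show "(\<lambda>u. mixture_data n M \<mu> \<sigma> u $ i) \<in> borel_measurable (vec_borel n)"
    by (rule measurable_cong[THEN iffD1, rotated]) (simp add: mixture_data_index[OF assms _ i] del: index_mult_mat_vec)
qed (rule mixture_data_carrier[OF assms])

lemma measurable_stat_A:
  assumes M: "membership_mat n \<tau> M"
  shows "stat_A M \<in> vec_borel n \<rightarrow>\<^sub>M vec_borel \<tau>"
proof (rule measurable_vec_borelI)
  fix k assume k: "k < \<tau>"
  have "(\<lambda>y. (\<Sum>j\<in>component_indices n M k. y $ j) / real (card (component_indices n M k)))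
      \<in> borel_measurable (vec_borel n)"
    by (intro borel_measurable_divide borel_measurable_sum borel_measurable_vec_index borel_measurable_const)
      (simp add: component_indices_def)
  then show "(\<lambda>y. stat_A M y $ k) \<in> borel_measurable (vec_borel n)"
    by (rule measurable_cong[THEN iffD1, rotated]) (simp add: stat_A_index[OF M _ k])
qed (rule stat_A_carrier[OF M])

lemma measurable_stat_B:
  assumes M: "membership_mat n \<tau> M"
  shows "stat_B n \<tau> M \<in> vec_borel n \<rightarrow>\<^sub>M vec_borel \<tau>"
proof (rule measurable_vec_borelI)
  fix k assume k: "k < \<tau>"
  define I where "I = component_indices n M k"
  have pick: "pick I r < n" if "r < card I" for r
    using pick_in_set[of r I] that by (auto simp: I_def component_indices_def)
  have [measurable]: "(\<lambda>y. stat_A M y $ k) \<in> borel_measurable (vec_borel n)"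
    by (rule measurable_compose[OF measurable_stat_A[OF M] borel_measurable_vec_index[OF k]])
  have "(\<lambda>y. (y $ pick I r - stat_A M y $ k)\<^sup>2) \<in> borel_measurable (vec_borel n)" if "r < card I" for r
    using borel_measurable_vec_index[OF pick[OF that]] by simp
  then have "(\<lambda>y. sqrt (\<Sum>r<card I. (y $ pick I r - stat_A M y $ k)\<^sup>2)) \<in> borel_measurable (vec_borel n)"
    by simp
  then show "(\<lambda>y. stat_B n \<tau> M y $ k) \<in> borel_measurable (vec_borel n)"
    by (rule measurable_cong[THEN iffD1, rotated]) (simp add: stat_B_index[OF M _ k] I_def)
qed (rule stat_B_carrier[OF M])

text \<open>The estimator takes countably many values, so it suffices to treat each fixed value
  \<open>w\<close> in its place.\<close>

lemma borel_measurable_F_more_likely: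
  assumes M: "membership_mat n \<tau> M" and "component_estimator n tauhat" and "cond_law_version n tauhat \<tau> M P"
  shows "(\<lambda>y. F_more_likely P (tauhat y) (stat_A M y) (stat_B n \<tau> M y)) \<in> borel_measurable (vec_borel n)"
proof -
  note [measurable] = measurable_stat_A[OF M] measurable_stat_B[OF M]
  have tauhat: "tauhat \<in> vec_borel n \<rightarrow>\<^sub>M count_space UNIV"
    using assms(2) by (simp add: component_estimator_def)
  have "(\<lambda>s. pmf (case_prod P s) k) \<in> borel_measurable (vec_borel \<tau> \<Otimes>\<^sub>M vec_borel \<tau>)" for k
    using assms(3) by (simp add: cond_law_version_def case_prod_unfold)
  then have [measurable]: "(\<lambda>s. prob_more_likely (case_prod P s) w)
      \<in> borel_measurable (vec_borel \<tau> \<Otimes>\<^sub>M vec_borel \<tau>)" for w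
    by (rule borel_measurable_prob_more_likely)
  have "(\<lambda>y. prob_more_likely (case_prod P (stat_A M y, stat_B n \<tau> M y)) (tauhat y))
      \<in> borel_measurable (vec_borel n)"
    by (rule measurable_compose_countable[OF _ tauhat]) measurable
  then show ?thesis
    by (simp add: F_more_likely_eq)
qed

section \<open>Coverage probability\<close>

text \<open>The conditional-law bound with \<open>AB\<close> the pair of statistics and
  \<open>W\<close> the estimate. That the normal law is a probability measure is a hypothesis here,
  discharged below through the law of \<open>U\<close>.\<close>

lemma prob_F_more_likely_le:
  assumes N: "prob_space (std_normal_vec n)" and \<theta>: "mixture_param n \<tau> M \<mu> \<sigma>"
    and "component_estimator n tauhat" and law: "cond_law_version n tauhat \<tau> M P"
    and "0 \<le> \<alpha>" "\<alpha> \<le> 1"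
  defines "Y \<equiv> mixture_data n M \<mu> \<sigma>"
  shows "\<alpha> \<le> measure (std_normal_vec n)
    {u \<in> space (std_normal_vec n). F_more_likely P (tauhat (Y u)) (stat_A M (Y u)) (stat_B n \<tau> M (Y u)) \<le> \<alpha>}"
proof -
  interpret prob_space "std_normal_vec n"
    by (rule N)
  have M: "membership_mat n \<tau> M"
    using \<theta> by (simp add: mixture_param_def)
  have sets_N[measurable_cong]: "sets (std_normal_vec n) = sets (vec_borel n)"
    by (simp add: std_normal_vec_def)
  have [measurable]: "Y \<in> vec_borel n \<rightarrow>\<^sub>M vec_borel n"
    unfolding Y_def by (rule measurable_mixture_data[OF membership_carrier[OF M]])
  note [measurable] = measurable_stat_A[OF M] measurable_stat_B[OF M]
  have [measurable]: "tauhat \<in> vec_borel n \<rightarrow>\<^sub>M count_space UNIV"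
    using assms(3) by (simp add: component_estimator_def)
  define AB where "AB u = (stat_A M (Y u), stat_B n \<tau> M (Y u))" for u
  have "\<alpha> \<le> prob {u \<in> space (std_normal_vec n). prob_more_likely (case_prod P (AB u)) (tauhat (Y u)) \<le> \<alpha>}"
  proof (rule prob_more_likely_cond_law_le[where AB = AB and Q = "case_prod P" and W = "\<lambda>u. tauhat (Y u)"
        and S = "vec_borel \<tau> \<Otimes>\<^sub>M vec_borel \<tau>"])
    show "AB \<in> std_normal_vec n \<rightarrow>\<^sub>M vec_borel \<tau> \<Otimes>\<^sub>M vec_borel \<tau>"
      unfolding AB_def by measurable
    show "(\<lambda>u. tauhat (Y u)) \<in> std_normal_vec n \<rightarrow>\<^sub>M count_space UNIV"
      by measurable
    show "(\<lambda>s. pmf (case_prod P s) k) \<in> borel_measurable (vec_borel \<tau> \<Otimes>\<^sub>M vec_borel \<tau>)" for k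
      using law by (simp add: cond_law_version_def case_prod_unfold)
    show "AE u in std_normal_vec n. pmf (case_prod P (AB u)) k =
        real_cond_exp (std_normal_vec n)
          (vimage_algebra (space (std_normal_vec n)) AB (vec_borel \<tau> \<Otimes>\<^sub>M vec_borel \<tau>))
          (indicator {u \<in> space (std_normal_vec n). tauhat (Y u) = k}) u" for k
      using law \<theta> by (simp add: cond_law_version_def Let_def AB_def[abs_def] Y_def)
  qed fact+
  then show ?thesis
    by (simp add: F_more_likely_eq AB_def)
qed

theorem corollary4:
  fixes n \<tau>\<^sub>0 :: nat and M\<^sub>0 :: "real mat" and \<mu>\<^sub>0 \<sigma>\<^sub>0 :: "real vec" and \<alpha> :: real
    and \<Omega> :: "'w measure" and U :: "'w \<Rightarrow> real vec" and tauhat :: "real vec \<Rightarrow> nat"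
    and P :: "nat \<Rightarrow> real mat \<Rightarrow> real vec \<Rightarrow> real vec \<Rightarrow> nat pmf"
  assumes "prob_space \<Omega>"
    and "U \<in> \<Omega> \<rightarrow>\<^sub>M vec_borel n" and "distr \<Omega> (vec_borel n) U = std_normal_vec n"
    and "true_mixture_param n \<tau>\<^sub>0 M\<^sub>0 \<mu>\<^sub>0 \<sigma>\<^sub>0"
    and "component_estimator n tauhat"
    and "\<And>\<tau> M. membership_mat n \<tau> M \<Longrightarrow> cond_law_version n tauhat \<tau> M (P \<tau> M)"
    and "0 < \<alpha>" and "\<alpha> < 1"
  shows "(\<forall>y\<^sub>o\<^sub>b\<^sub>s\<in>carrier_vec n.
            Xi_set n tauhat P \<alpha> y\<^sub>o\<^sub>b\<^sub>s =
            {\<tau>. \<exists>M. membership_mat n \<tau> M \<and>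
               F_more_likely (P \<tau> M) (tauhat y\<^sub>o\<^sub>b\<^sub>s) (stat_A M y\<^sub>o\<^sub>b\<^sub>s) (stat_B n \<tau> M y\<^sub>o\<^sub>b\<^sub>s) \<le> \<alpha>})
       \<and> measure \<Omega> {\<omega> \<in> space \<Omega>.
            \<tau>\<^sub>0 \<in> Xi_set n tauhat P \<alpha> (mixture_data n M\<^sub>0 \<mu>\<^sub>0 \<sigma>\<^sub>0 (U \<omega>))} \<ge> \<alpha>"
proof (intro conjI ballI)
  show "Xi_set n tauhat P \<alpha> y = {\<tau>. \<exists>M. membership_mat n \<tau> M \<and>
      F_more_likely (P \<tau> M) (tauhat y) (stat_A M y) (stat_B n \<tau> M y) \<le> \<alpha>}"
    if "y \<in> carrier_vec n" for y
    using that by (rule Xi_set_eq)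
next
  have \<theta>: "mixture_param n \<tau>\<^sub>0 M\<^sub>0 \<mu>\<^sub>0 \<sigma>\<^sub>0" and M\<^sub>0: "membership_mat n \<tau>\<^sub>0 M\<^sub>0"
    using assms(4) by (auto simp: true_mixture_param_def mixture_param_def)
  define N where "N = std_normal_vec n"
  define Y where "Y = mixture_data n M\<^sub>0 \<mu>\<^sub>0 \<sigma>\<^sub>0"
  define F where "F M y = F_more_likely (P \<tau>\<^sub>0 M) (tauhat y) (stat_A M y) (stat_B n \<tau>\<^sub>0 M y)" for M y
  \<comment> \<open>The normal law is the image of the probability measure on \<Omega> under
    \<open>U\<close>.\<close>
  interpret N: prob_space N
    unfolding N_def assms(3)[symmetric] by (rule prob_space.prob_space_distr[OF assms(1,2)])
  have sets_N[measurable_cong]: "sets N = sets (vec_borel n)"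
    by (simp add: N_def std_normal_vec_def)
  have space_N: "space N = carrier_vec n"
    using sets_eq_imp_space_eq[OF sets_N] by simp
  have Y[measurable]: "Y \<in> vec_borel n \<rightarrow>\<^sub>M vec_borel n"
    unfolding Y_def by (rule measurable_mixture_data[OF membership_carrier[OF M\<^sub>0]])
  have [measurable]: "F M \<in> borel_measurable (vec_borel n)" if "membership_mat n \<tau>\<^sub>0 M" for M
    unfolding F_def using that by (intro borel_measurable_F_more_likely assms(5,6))
  define E where "E M = {u \<in> space N. F M (Y u) \<le> \<alpha>}" for M
  have E: "E M \<in> sets N" if [measurable]: "membership_mat n \<tau>\<^sub>0 M" for M
    unfolding E_def using that by measurable
  \<comment> \<open>Noise vectors for which some membership matrix with
    \<open>\<tau>\<^sub>0\<close> columns is accepted; a finite union of events.\<close>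
  define G where "G = (\<Union>M\<in>{M. membership_mat n \<tau>\<^sub>0 M}. E M)"
  have G: "G \<in> sets N"
    unfolding G_def using finite_membership_mats E by (intro sets.finite_UN) auto
  have Xi: "\<tau>\<^sub>0 \<in> Xi_set n tauhat P \<alpha> (Y (U \<omega>)) \<longleftrightarrow> U \<omega> \<in> G" if "\<omega> \<in> space \<Omega>" for \<omega>
  proof -
    have U: "U \<omega> \<in> carrier_vec n"
      using measurable_space[OF assms(2) that] by simp
    then have "Y (U \<omega>) \<in> carrier_vec n"
      using measurable_space[OF Y] by simp
    then show ?thesis
      using U by (auto simp: Xi_set_eq G_def E_def F_def space_N)
  qed
  \<comment> \<open>Acceptance of the true matrix alone reaches the level; the other matrices can
    only enlarge the event.\<close>
  have "\<alpha> \<le> measure N (E M\<^sub>0)"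
    unfolding E_def F_def N_def Y_def
    using N.prob_space_axioms \<theta> assms(5) assms(6)[OF M\<^sub>0] assms(7,8)
    by (intro prob_F_more_likely_le) (auto simp: N_def)
  also have "\<dots> \<le> measure N G"
    using G M\<^sub>0 by (intro N.finite_measure_mono) (auto simp: G_def)
  also have "\<dots> = measure \<Omega> (U -` G \<inter> space \<Omega>)"
    using G unfolding N_def assms(3)[symmetric] by (intro measure_distr assms(2)) simp
  also have "U -` G \<inter> space \<Omega> = {\<omega> \<in> space \<Omega>. \<tau>\<^sub>0 \<in> Xi_set n tauhat P \<alpha> (Y (U \<omega>))}"
    using Xi by auto
  finally show "\<alpha> \<le> measure \<Omega> {\<omega> \<in> space \<Omega>. \<tau>\<^sub>0 \<in> Xi_set n tauhat P \<alpha> (mixture_data n M\<^sub>0 \<mu>\<^sub>0 \<sigma>\<^sub>0 (U \<omega>))}"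
    unfolding Y_def .
qed

end
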